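(* For every real number $a>1/2$ and every integer $d\geq 2$, $$\sum_{k=0}^{d-2}\binom{d}{k}a^{d-k}\,{}_{d+1}F_d\Bigl(\begin{matrix}1_{d-k},\,2_k,\,ad+1\\ a+2,a+2,\ldots,a+2\end{matrix}\Bigl|1\Bigr)=(a+1)^d-\frac{\Gamma(a+2)^d}{\Gamma(ad+1)},$$ where $1_{d-k}$ denotes the list $1,\ldots,1$ of length $d-k$, $2_k$ denotes the list $2,\ldots,2$ of length $k$, and the lower parameter $a+2$ is repeated $d$ times.
   Context: $\Gamma$ is the Euler Gamma function. The generalized hypergeometric function is defined by the series $${}_{p}F_q\Bigl(\begin{matrix}a_1,\ldots,a_p\\ b_1,\ldots,b_q\end{matrix}\Bigl|z\Bigr)=\sum_{n=0}^{\infty}\frac{(a_1)_n\cdots(a_p)_n}{(b_1)_n\cdots(b_q)_n\,n!}\,z^n,$$ where $(x)_n$ is the rising Pochhammer symbol: $(x)_0=1$ and $(x)_n=x(x+1)\cdots(x+n-1)$ for $n\ge 1$. The value at $z=1$ is the sum of the series at $z=1$. *)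

theory Defs
  imports "HOL-Analysis.Analysis" "HOL-Computational_Algebra.Formal_Power_Series"
begin

(* The n-th coefficient of fps_hypergeo as bs z is the full n-th term of the
   hypergeometric series at z (the power z ^ n and the factor 1 / n! included), so pFq is
   the plain sum of these coefficients; see pFq_eq_suminf below.  As always with suminf,
   the value is meaningful only where the series converges, and this depends on the
   parameters when |z| = 1 and there are as many lower parameters as upper ones less one. *)
definition pFq :: "'a::real_normed_field list \<Rightarrow> 'a list \<Rightarrow> 'a \<Rightarrow> 'a" where
  "pFq as bs z = (\<Sum>n. fps_nth (fps_hypergeo as bs z) n)"

lemma fps_hypergeo_nth_prod_list:
  "fps_nth (fps_hypergeo as bs z) n =
     (\<Prod>a\<leftarrow>as. pochhammer a n) / ((\<Prod>b\<leftarrow>bs. pochhammer b n) * fact n) * z ^ n"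
proof -
  have "foldl (\<lambda>r a. r * pochhammer a n) c xs = c * (\<Prod>a\<leftarrow>xs. pochhammer a n)"
    for c :: 'a and xs
    by (induction xs arbitrary: c) (simp_all add: mult.assoc)
  then show ?thesis by simp
qed

lemma pFq_eq_suminf:
  fixes z :: "'a::real_normed_field"
  shows "pFq as bs z =
    (\<Sum>n. (\<Prod>a\<leftarrow>as. pochhammer a n) / ((\<Prod>b\<leftarrow>bs. pochhammer b n) * fact n) * z ^ n)"
  by (simp only: pFq_def fps_hypergeo_nth_prod_list)

end

theory Submission
  imports Defs
begin

text \<open>
  Put \<open>x = n + 1\<close>. Since \<open>(2)\<^sub>n = x (1)\<^sub>n\<close>, the \<open>n\<close>-th terms of the series indexed by \<open>k\<close> differ only in the
  factor \<open>x\<^sup>k\<close>, so by the binomial theorem the left-hand side has as its \<open>n\<close>-th term the multiple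
  of \<open>(x + a)\<^sup>d - x\<^sup>d - d a x\<^sup>d\<^sup>-\<^sup>1 = (x + a)\<^sup>d - x\<^sup>d\<^sup>-\<^sup>1 (x + a d)\<close> by the term with \<open>k = 0\<close>. This telescopes as
  \<open>T\<^sub>n - T\<^sub>n\<^sub>+\<^sub>1\<close>, where \<open>T\<^sub>n\<close> is the term with \<open>k = 0\<close> times \<open>(x + a)\<^sup>d\<close>, and the limit of \<open>T\<^sub>n\<close>
  is given by Euler's product for the Gamma function.
\<close>

text \<open>This is \<open>T\<close> of the overview; the exponent \<open>d - 1\<close> remains
  after one of the d factors \<open>pochhammer 1 n\<close> has cancelled the n! of the
  series.\<close>

definition tele :: "real \<Rightarrow> nat \<Rightarrow> nat \<Rightarrow> real" where
  "tele a d n = fact n ^ (d - 1) * pochhammer (a * real d + 1) n * (real n + 1 + a) ^ d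
     / pochhammer (a + 2) n ^ d"

lemma tele_nonneg:
  assumes "a > 0"
  shows "tele a d n \<ge> 0"
proof -
  have "pochhammer (a * real d + 1) n > 0" "pochhammer (a + 2) n > 0"
    using assms by (auto intro!: pochhammer_pos add_nonneg_pos)
  then show ?thesis using assms by (simp add: tele_def)
qed

text \<open>The new factor of \<open>pochhammer (a + 2) (Suc n)\<close> is n + 2 + a, whose d-th
  power cancels the last factor in the numerator of \<open>tele a d (Suc n)\<close>.\<close>

lemma tele_Suc:
  assumes "a > 0"
  shows "tele a d (Suc n) = tele a d n / (real n + 1 + a) ^ d
     * ((real n + 1) ^ (d - 1) * (real n + 1 + a * real d))"
proof -
  have "real n + 1 + a > 0" "real n + 2 + a > 0" "pochhammer (a + 2) n > 0"
    using assms by (auto intro!: pochhammer_pos)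
  then show ?thesis
    by (simp add: tele_def pochhammer_rec' power_mult_distrib add_ac divide_simps)
qed

lemma tele_LIMSEQ:
  assumes a: "a > 0" and d: "d > 0"
  shows "tele a d \<longlonglongrightarrow> Gamma (a + 2) ^ d / Gamma (a * real d + 1)"
proof -
  \<comment> \<open>The correction factor tends to 1 and equals ((n + 1 + a) / n)^d, which supplies
    the power of n + 1 + a in \<open>tele\<close>.\<close>
  define G where "G n = Gamma_series' (a + 2) n ^ d / Gamma_series' (a * real d + 1) n
    * (1 + (1 + a) / real n) ^ d" for n
  have ad: "a * real d + 1 > 0" using a by (simp add: add_nonneg_pos)
  have "(\<lambda>n. 1 + (1 + a) / real n) \<longlonglongrightarrow> 1 + 0"
    by (intro tendsto_add tendsto_const lim_const_over_n)
  then have "G \<longlonglongrightarrow> Gamma (a + 2) ^ d / Gamma (a * real d + 1) * (1 + 0) ^ d"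
    unfolding G_def using Gamma_real_pos[OF ad]
    by (intro tendsto_mult tendsto_divide tendsto_power Gamma_series'_LIMSEQ) auto
  \<comment> \<open>At n = 0 the factor \<open>(1 + a) / real n\<close> divides by zero, so equality
    is claimed only from 1 on.\<close>
  moreover have "G n = tele a d n" if n: "n > 0" for n
  proof -
    define L where "L = ln (real n)"
    obtain m where d': "d = Suc m" using d gr0_conv_Suc by blast
    have fn: "fact n = real n * fact (n - 1)" using n by (rule fact_reduce)
    have p: "pochhammer (a * real d + 1) n > 0" "pochhammer (a + 2) n > 0"
      using a ad by (auto intro!: pochhammer_pos)
    \<comment> \<open>The surplus power of n is (a + 2) d - (a d + 1) = 2 d - 1 = d + m: d of these
      cancel the \<open>real n ^ d\<close> of the correction factor, and m turn
      \<open>fact (n - 1) ^ m\<close> into \<open>fact n ^ m\<close>.\<close>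
    have e: "exp ((a + 2) * L) ^ d = exp ((a * real d + 1) * L) * real n ^ (d + m)"
    proof -
      have "real n ^ (d + m) = exp (real (d + m) * L)"
        using n by (simp add: L_def exp_of_nat_mult del: of_nat_add)
      then show ?thesis
        by (simp add: d' exp_of_nat_mult[symmetric] exp_add[symmetric] algebra_simps
            del: power_Suc)
    qed
    have "G n = (fact (n - 1) * exp ((a + 2) * L) / pochhammer (a + 2) n) ^ d
        / (fact (n - 1) * exp ((a * real d + 1) * L) / pochhammer (a * real d + 1) n)
        * ((real n + 1 + a) / real n) ^ d"
      using n by (simp add: G_def Gamma_series'_def L_def field_simps)
    also have "\<dots> = (fact (n - 1) ^ d * (exp ((a * real d + 1) * L) * real n ^ (d + m))
          / pochhammer (a + 2) n ^ d)
        / (fact (n - 1) * exp ((a * real d + 1) * L) / pochhammer (a * real d + 1) n)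
        * ((real n + 1 + a) ^ d / real n ^ d)"
      by (simp only: power_divide power_mult_distrib e)
    also have "\<dots> = tele a d n"
      using n p by (simp add: tele_def d' fn power_mult_distrib power_add divide_simps)
    finally show ?thesis .
  qed
  then have "eventually (\<lambda>n. G n = tele a d n) sequentially"
    using eventually_gt_at_top[of 0] by (rule eventually_mono[rotated])
  ultimately show ?thesis
    by (simp add: filterlim_cong[OF refl refl, of G "tele a d"])
qed

lemma fps_hypergeo_nth_eq_tele:
  assumes "a > 0" "k \<le> d" "d > 0"
  shows "fps_nth (fps_hypergeo
      (replicate (d - k) 1 @ replicate k 2 @ [a * real d + 1]) (replicate d (a + 2)) 1) n
    = tele a d n / (real n + 1 + a) ^ d * (real n + 1) ^ k"
proof -
  \<comment> \<open>Both sides equal (n + 1)!, the value of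
    \<open>pochhammer 1 (Suc n)\<close>.\<close>
  have two: "pochhammer 2 n = fact n * (real n + 1)"
    using pochhammer_rec[of "1::real" n] by (simp add: pochhammer_fact[symmetric] algebra_simps)
  have one: "pochhammer (1::real) n = fact n" by (simp add: pochhammer_fact)
  have "(fact n :: real) ^ (d - k) * fact n ^ k = fact n * fact n ^ (d - 1)"
    using assms by (simp flip: power_add power_Suc)
  then have f: "(fact n :: real) ^ (d - k) * (fact n ^ k * c) = fact n * fact n ^ (d - 1) * c" for c
    by (simp only: mult.assoc[symmetric])
  have "real n + 1 + a > 0" "pochhammer (a + 2) n > 0"
    using assms by (auto intro!: pochhammer_pos)
  then show ?thesis
    unfolding fps_hypergeo_nth_prod_list
    by (simp add: tele_def one two power_mult_distrib f mult.assoc prod_list_replicate)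
qed

text \<open>\<open>tele a d\<close> converges, hence is bounded, and the gap of 2 between k and d
  leaves a comparison with the series of 1 / (n + 1)^2.\<close>

lemma summable_tele_power:
  assumes "a > 0" and "k + 2 \<le> d"
  shows "summable (\<lambda>n. tele a d n / (real n + 1 + a) ^ d * (real n + 1) ^ k)"
proof -
  have "Bseq (tele a d)"
    using assms by (intro convergent_imp_Bseq convergentI[OF tele_LIMSEQ]) auto
  then obtain B where B: "B > 0" "\<And>n. norm (tele a d n) \<le> B"
    by (rule BseqE) blast
  show ?thesis
  proof (rule summable_comparison_test')
    show "summable (\<lambda>n. B * inverse (real (Suc n) ^ 2))"
      using inverse_power_summable[of 2, where 'a = real]
      by (intro summable_mult) (simp only: summable_Suc_iff[of "\<lambda>n. inverse (real n ^ 2)"])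
    fix n :: nat
    have x: "real n + 1 > 0" by simp
    have "(real n + 1) ^ k * (real n + 1)\<^sup>2 \<le> (real n + 1) ^ d"
      using assms power_increasing[of "k + 2" d "real n + 1"] by (simp only: power_add)
    also have "\<dots> \<le> (real n + 1 + a) ^ d"
      using assms by (intro power_mono) auto
    finally have "(real n + 1) ^ k / (real n + 1 + a) ^ d \<le> inverse ((real n + 1)\<^sup>2)"
      using assms by (simp add: divide_simps)
    then have "tele a d n * ((real n + 1) ^ k / (real n + 1 + a) ^ d)
        \<le> B * inverse ((real n + 1)\<^sup>2)"
      using B(1) B(2)[of n] assms by (intro mult_mono) auto
    then show "norm (tele a d n / (real n + 1 + a) ^ d * (real n + 1) ^ k)
        \<le> B * inverse (real (Suc n) ^ 2)"
      using assms tele_nonneg[of a d n] by (simp add: add.commute abs_mult)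
  qed
qed

text \<open>The omitted terms k = d - 1 and k = d of the binomial expansion add up to the subtracted
  product, which for x = n + 1 is the factor in \<open>tele_Suc\<close>.\<close>

lemma binomial_sum_drop_last_two:
  fixes a x :: real
  assumes "d \<ge> 2"
  shows "(\<Sum>k = 0..d - 2. real (d choose k) * a ^ (d - k) * x ^ k)
    = (x + a) ^ d - x ^ (d - 1) * (x + a * real d)"
proof -
  obtain m where d: "d = Suc (Suc m)"
    using assms by (metis add_2_eq_Suc le_Suc_ex)
  have "(x + a) ^ d = (\<Sum>k\<le>d. real (d choose k) * x ^ k * a ^ (d - k))"
    by (rule binomial_ring)
  also have "\<dots> = (\<Sum>k\<le>m. real (d choose k) * x ^ k * a ^ (d - k))
      + real d * x ^ Suc m * a + x ^ d"
    by (simp add: d)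
  finally show ?thesis
    by (simp add: d atLeast0AtMost algebra_simps)
qed

theorem theorem2p2:
  fixes a :: real and d :: nat
  assumes "a > 1 / 2" and "d \<ge> 2"
  shows "(\<forall>k\<in>{0..d - 2}. summable (fps_nth (fps_hypergeo
              (replicate (d - k) 1 @ replicate k 2 @ [a * real d + 1]) (replicate d (a + 2)) 1)))
       \<and> (\<Sum>k = 0..d - 2. real (d choose k) * a ^ (d - k) *
            pFq (replicate (d - k) 1 @ replicate k 2 @ [a * real d + 1]) (replicate d (a + 2)) 1)
         = (a + 1) ^ d - Gamma (a + 2) ^ d / Gamma (a * real d + 1)"
proof -
  have a: "a > 0" using assms by simp
  define t where "t k n = tele a d n / (real n + 1 + a) ^ d * (real n + 1) ^ k" for k n
  have nth: "fps_nth (fps_hypergeo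
      (replicate (d - k) 1 @ replicate k 2 @ [a * real d + 1]) (replicate d (a + 2)) 1) = t k"
    if "k \<in> {0..d - 2}" for k
    using that assms a by (intro ext) (simp only: t_def, rule fps_hypergeo_nth_eq_tele, auto)
  have summable: "summable (t k)" if "k \<in> {0..d - 2}" for k
    unfolding t_def using that assms a by (intro summable_tele_power) auto
  have "(\<Sum>k = 0..d - 2. real (d choose k) * a ^ (d - k) * t k n) = tele a d n - tele a d (Suc n)"
    for n
  proof -
    have "(\<Sum>k = 0..d - 2. real (d choose k) * a ^ (d - k) * t k n)
        = tele a d n / (real n + 1 + a) ^ d *
          (\<Sum>k = 0..d - 2. real (d choose k) * a ^ (d - k) * (real n + 1) ^ k)"
      by (simp add: t_def sum_distrib_left mult_ac)
    also have "\<dots> = tele a d n - tele a d (Suc n)"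
      using a by (simp add: binomial_sum_drop_last_two[OF assms(2)] tele_Suc right_diff_distrib)
    finally show ?thesis .
  qed
  moreover have "(\<lambda>n. \<Sum>k = 0..d - 2. real (d choose k) * a ^ (d - k) * t k n)
      sums (\<Sum>k = 0..d - 2. real (d choose k) * a ^ (d - k) * suminf (t k))"
    by (intro sums_sum sums_mult summable_sums summable)
  \<comment> \<open>The same series is now summed by telescoping; its first term
    \<open>tele a d 0\<close> is (a + 1)^d, since the factorial and both Pochhammer symbols are 1 at
    0.\<close>
  moreover have "(\<lambda>n. tele a d n - tele a d (Suc n))
      sums (tele a d 0 - Gamma (a + 2) ^ d / Gamma (a * real d + 1))"
    using assms a by (intro telescope_sums' tele_LIMSEQ) auto
  ultimately have "(\<Sum>k = 0..d - 2. real (d choose k) * a ^ (d - k) * suminf (t k))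
      = (a + 1) ^ d - Gamma (a + 2) ^ d / Gamma (a * real d + 1)"
    using sums_unique2 by (fastforce simp: tele_def add.commute)
  then show ?thesis
    by (simp add: nth summable pFq_def del: fps_hypergeo_nth)
qed

end
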